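(* Let $\ell>0$, $\alpha>0$ and $N\in\mathbb{N}$, $N\ge 1$. Let $x_1^{\mathrm{GH}},\ldots,x_N^{\mathrm{GH}}$ and $w_1^{\mathrm{GH}},\ldots,w_N^{\mathrm{GH}}$ be the nodes and weights of the $N$-point Gauss--Hermite quadrature rule. Define the nodes $$\tilde{x}_n = \frac{1}{\sqrt{2}\,\alpha\beta}\, x_n^{\mathrm{GH}},\qquad n=1,\ldots,N.$$ Then the weights $\widetilde{w}_k=(\widetilde w_{k,1},\ldots,\widetilde w_{k,N})\in\mathbb{R}^N$ of the $N$-point quadrature rule $\widetilde{Q}_k(f) = \sum_{n=1}^N \widetilde{w}_{k,n} f(\tilde{x}_n)$ defined by the exactness conditions $\widetilde{Q}_k(\varphi_n^\alpha) = \mu(\varphi_n^\alpha)$ for $n=0,\ldots,N-1$ are $$\widetilde{w}_{k,n} = \Big(\frac{1}{1+2\delta^2}\Big)^{1/2} w_n^{\mathrm{GH}}\, e^{\delta^2 \tilde{x}_n^2} \sum_{m=0}^{\lfloor (N-1)/2\rfloor} \frac{1}{2^m m!}\Big(\frac{2\alpha^2\beta^2}{1+2\delta^2}-1\Big)^m \mathrm{H}_{2m}(x_n^{\mathrm{GH}}),\qquad n=1,\ldots,N.$$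
   Context: $\mu$ is the standard Gaussian measure on $\mathbb{R}$ and $\mu(f)=\frac{1}{\sqrt{2\pi}}\int_{\mathbb{R}} f(x)e^{-x^2/2}\,\mathrm{d}x$. $\mathrm{H}_n(x) = (-1)^n e^{x^2/2}\frac{\mathrm{d}^n}{\mathrm{d}x^n}e^{-x^2/2}$ are the probabilists' Hermite polynomials. The $N$-point Gauss--Hermite quadrature rule is the unique $N$-point rule with $\sum_{n=1}^N w_n^{\mathrm{GH}}p(x_n^{\mathrm{GH}})=\mu(p)$ for every polynomial $p$ of degree at most $2N-1$; its nodes are the roots of $\mathrm{H}_N$. For $\ell>0$ (the length-scale of the Gaussian kernel $k(x,y)=\exp(-(x-y)^2/(2\ell^2))$) and $\alpha>0$ define $$\epsilon=\frac{1}{\sqrt2\,\ell},\qquad \beta=\Big(1+\Big(\frac{2\epsilon}{\alpha}\Big)^2\Big)^{1/4},\qquad \delta^2=\frac{\alpha^2}{2}(\beta^2-1).$$ The functions $$\varphi_n^\alpha(x)=\sqrt{\frac{\beta}{n!}}\,e^{-\delta^2x^2}\,\mathrm{H}_n(\sqrt2\,\alpha\beta x),\qquad n\ge 0,$$ are the Mercer eigenfunctions of $k$ with respect to the Gaussian probability measure with density $\frac{\alpha}{\sqrt{\pi}}e^{-\alpha^2x^2}$. The convention $0^0=1$ is used. *)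

theory Defs
  imports "HOL-Probability.Probability" "HOL-Computational_Algebra.Polynomial"
begin

definition gaussian_mean :: "(real \<Rightarrow> real) \<Rightarrow> real" where
  "gaussian_mean f = (LINT x|std_normal_distribution. f x)"

lemma gaussian_mean_eq:
  assumes "f \<in> borel_measurable borel"
  shows "gaussian_mean f = 1 / sqrt (2 * pi) * (LINT x|lborel. f x * exp (- (x\<^sup>2 / 2)))"
proof -
  have "gaussian_mean f = (LINT x|lborel. std_normal_density x *\<^sub>R f x)"
    unfolding gaussian_mean_def using assms by (intro integral_density) auto
  also have "\<dots> = (LINT x|lborel. 1 / sqrt (2 * pi) * (f x * exp (- (x\<^sup>2 / 2))))"
    by (intro Bochner_Integration.integral_cong) (auto simp: std_normal_density_def)
  finally show ?thesis
    by (simp only: integral_mult_right_zero)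
qed

text \<open>Probabilists' Hermite polynomials, as functions, by Rodrigues' formula.\<close>

definition hermite :: "nat \<Rightarrow> real \<Rightarrow> real" where
  "hermite n x = (- 1) ^ n * exp (x\<^sup>2 / 2) * (deriv ^^ n) (\<lambda>t. exp (- (t\<^sup>2 / 2))) x"

text \<open>Nodes and weights are indexed by \<open>{1..N}\<close>; values outside this range are irrelevant.\<close>

definition quadrature :: "nat \<Rightarrow> (nat \<Rightarrow> real) \<Rightarrow> (nat \<Rightarrow> real) \<Rightarrow> (real \<Rightarrow> real) \<Rightarrow> real" where
  "quadrature N x w f = (\<Sum>n = 1..N. w n * f (x n))"

text \<open>The defining property determines the rule only up to the order in which the nodes are
  listed, so it is a predicate on the enumerated nodes and weights. It is meant for
  \<open>N \<ge> 1\<close>, where the natural-number subtraction is exact.\<close>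

definition gauss_hermite_rule :: "nat \<Rightarrow> (nat \<Rightarrow> real) \<Rightarrow> (nat \<Rightarrow> real) \<Rightarrow> bool" where
  "gauss_hermite_rule N x w \<longleftrightarrow>
     inj_on x {1..N} \<and>
     (\<forall>p :: real poly. degree p \<le> 2 * N - 1 \<longrightarrow> quadrature N x w (poly p) = gaussian_mean (poly p))"

definition eps :: "real \<Rightarrow> real" where
  "eps ell = 1 / (sqrt 2 * ell)"

definition beta :: "real \<Rightarrow> real \<Rightarrow> real" where
  "beta ell \<alpha> = (1 + (2 * eps ell / \<alpha>)\<^sup>2) powr (1 / 4)"

text \<open>Only the square of \<open>\<delta>\<close> is ever used.\<close>

definition delta_sq :: "real \<Rightarrow> real \<Rightarrow> real" where
  "delta_sq ell \<alpha> = \<alpha>\<^sup>2 / 2 * ((beta ell \<alpha>)\<^sup>2 - 1)"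

text \<open>Mercer eigenfunctions of the Gaussian kernel with length-scale \<open>ell\<close>, with respect to the
  probability density \<open>\<alpha> / sqrt pi * exp (- \<alpha>\<^sup>2 * x\<^sup>2)\<close>.\<close>

definition mercer_eigenfun :: "real \<Rightarrow> real \<Rightarrow> nat \<Rightarrow> real \<Rightarrow> real" where
  "mercer_eigenfun ell \<alpha> n x =
     sqrt (beta ell \<alpha> / fact n) * exp (- delta_sq ell \<alpha> * x\<^sup>2) * hermite n (sqrt 2 * \<alpha> * beta ell \<alpha> * x)"

end

theory Submission
  imports Defs
begin

text \<open>
  Dividing out the factor \<open>exp (- \<delta>\<^sup>2 x\<^sup>2)\<close> turns the exactness conditions into a linear system
  with matrix \<open>H\<^sub>n(x\<^sub>j)\<close>. Gauss--Hermite quadrature integrates the products \<open>H\<^sub>n H\<^sub>m\<close> with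
  \<open>n, m < N\<close> exactly, so orthogonality of the Hermite polynomials gives the explicit inverse
  \<open>w\<^sub>j H\<^sub>m(x\<^sub>j) / m!\<close> of this matrix. The right-hand sides are, after rescaling, the means
  of \<open>H\<^sub>n(t Z)\<close> for a standard Gaussian \<open>Z\<close>; Gaussian integration by parts
  \<open>E (Z p(Z)) = E (p'(Z))\<close> reduces both these and the orthogonality relation to the three-term
  recurrence.
\<close>

section \<open>Hermite polynomials as formal polynomials\<close>

fun hermite_poly :: "nat \<Rightarrow> real poly" where
  "hermite_poly 0 = 1"
| "hermite_poly (Suc n) = [:0, 1:] * hermite_poly n - pderiv (hermite_poly n)"

text \<open>One derivative sends \<open>p(t) exp(-t^2/2)\<close> to
  \<open>(p'(t) - t p(t)) exp(-t^2/2)\<close>; up to sign this is the recursion of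
  \<open>hermite_poly\<close>.\<close>

lemma deriv_funpow_gaussian:
  "(deriv ^^ n) (\<lambda>t::real. exp (- (t\<^sup>2 / 2))) =
     (\<lambda>t. (- 1) ^ n * poly (hermite_poly n) t * exp (- (t\<^sup>2 / 2)))"
proof (induction n)
  case (Suc n)
  have "((\<lambda>t. (- 1) ^ n * poly (hermite_poly n) t * exp (- (t\<^sup>2 / 2))) has_field_derivative
      (- 1) ^ Suc n * poly (hermite_poly (Suc n)) t * exp (- (t\<^sup>2 / 2))) (at t)" for t :: real
    by (auto intro!: derivative_eq_intros simp: algebra_simps power2_eq_square)
  then show ?case
    by (auto simp: Suc intro!: DERIV_imp_deriv)
qed simp

lemma hermite_eq_poly: "hermite n = poly (hermite_poly n)"
proof
  fix x :: real
  have "hermite n x = ((- 1) ^ n * (- 1) ^ n) * (exp (x\<^sup>2 / 2) * exp (- (x\<^sup>2 / 2))) * poly (hermite_poly n) x"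
    by (simp only: hermite_def deriv_funpow_gaussian mult_ac)
  then show "hermite n x = poly (hermite_poly n) x"
    by (simp add: exp_add[symmetric] power_add[symmetric] flip: mult_2)
qed

text \<open>The Appell property: differentiation acts as a lowering operator. The induction
  differentiates the recursion.\<close>

lemma pderiv_hermite_poly: "pderiv (hermite_poly n) = smult (real n) (hermite_poly (n - 1))"
proof (induction n)
  case (Suc n)
  have "pderiv (hermite_poly (Suc n)) = hermite_poly n + [:0, 1:] * smult (real n) (hermite_poly (n - 1))
      - smult (real n) (pderiv (hermite_poly (n - 1)))"
    by (simp add: pderiv_diff pderiv_mult pderiv_pCons Suc pderiv_smult)
  also have "\<dots> = hermite_poly n + smult (real n) ([:0, 1:] * hermite_poly (n - 1) - pderiv (hermite_poly (n - 1)))"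
    by (simp add: smult_diff_right)
  also have "\<dots> = smult (real (Suc n)) (hermite_poly n)"
  proof -
    have "smult (real n) ([:0, 1:] * hermite_poly (n - 1) - pderiv (hermite_poly (n - 1))) =
        smult (real n) (hermite_poly n)"
      \<comment> \<open>For positive \<open>n\<close> the bracket is the recursion for
        \<open>hermite_poly n\<close>; for \<open>n = 0\<close>, where \<open>n - 1\<close>
        truncates to 0, the factor \<open>real n\<close> vanishes.\<close>
      by (cases n) simp_all
    then show ?thesis
      by (simp only: of_nat_Suc smult_add_left smult_1_left)
  qed
  finally show ?case by simp
qed simp

text \<open>Multiplication by the variable supplies the top term, and the derivative stays below it.
  Both claims share one induction since monicity excludes the zero polynomial in the step.\<close>

lemma degree_hermite_poly_lead:
  "degree (hermite_poly n) = n \<and> lead_coeff (hermite_poly n) = 1"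
proof (induction n)
  case (Suc n)
  then have nz: "hermite_poly n \<noteq> 0" by auto
  have deg: "degree ([:0, 1:] * hermite_poly n) = Suc n"
    using Suc nz by simp
  have "degree (pderiv (hermite_poly n)) < Suc n"
    using Suc by (simp add: degree_pderiv)
  moreover from this have "coeff (pderiv (hermite_poly n)) (Suc n) = 0"
    by (rule coeff_eq_0)
  moreover have "degree (hermite_poly (Suc n)) = Suc n"
    using degree_add_eq_left[of "- pderiv (hermite_poly n)" "[:0, 1:] * hermite_poly n"]
    by (metis calculation(1) deg degree_minus hermite_poly.simps(2) uminus_add_conv_diff
        diff_conv_add_uminus)
  ultimately show ?case
    using Suc by auto
qed simp

lemma degree_hermite_poly [simp]: "degree (hermite_poly n) = n"
  and coeff_hermite_poly_self [simp]: "coeff (hermite_poly n) n = 1"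
  using degree_hermite_poly_lead[of n] by auto

section \<open>Gaussian means of polynomials and integration by parts\<close>

lemma borel_measurable_poly [measurable]: "poly p \<in> borel_measurable (borel :: real measure)"
  by (intro borel_measurable_continuous_onI continuous_intros)

lemma integrable_poly_std_normal: "integrable std_normal_distribution (poly p)"
  by (simp add: poly_altdef[abs_def] integrable_std_normal_distribution_moment)

lemma gaussian_mean_poly_add:
  "gaussian_mean (poly (p + q)) = gaussian_mean (poly p) + gaussian_mean (poly q)"
  by (simp add: gaussian_mean_def integrable_poly_std_normal)

lemma gaussian_mean_poly_diff:
  "gaussian_mean (poly (p - q)) = gaussian_mean (poly p) - gaussian_mean (poly q)"
  by (simp add: gaussian_mean_def integrable_poly_std_normal)

lemma gaussian_mean_poly_smult:
  "gaussian_mean (poly (smult a p)) = a * gaussian_mean (poly p)"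
  by (simp add: gaussian_mean_def)

lemma gaussian_mean_poly_zero: "gaussian_mean (poly 0) = 0"
  using gaussian_mean_poly_smult[of 0 0] by simp

lemma gaussian_mean_one: "gaussian_mean (\<lambda>_. 1) = 1"
  using std_normal_distribution_even_moments(1)[of 0] by (simp add: gaussian_mean_def)

text \<open>The quotient \<open>(2k)! / (2^k k!)\<close> is the double factorial
  \<open>(2k - 1)!!\<close>, the Gaussian moment of order \<open>2k\<close>; it returns in the means
  of scaled Hermite polynomials.\<close>

lemma fact_even_moment_Suc:
  "(fact (Suc (Suc (2 * k))) / (2 ^ Suc k * fact (Suc k)) :: real) =
    real (Suc (2 * k)) * (fact (2 * k) / (2 ^ k * fact k))"
  by (simp add: divide_simps)

text \<open>Integration by parts for the monomial of degree \<open>k + 1\<close>, read off the known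
  moments; for odd \<open>k\<close> both sides vanish.\<close>

lemma gaussian_mean_power_Suc_Suc:
  "gaussian_mean (poly (monom 1 (Suc (Suc k)))) = real (Suc k) * gaussian_mean (poly (monom 1 k))"
proof (cases "even k")
  case True
  then obtain m where k: "k = 2 * m" by (elim evenE)
  have "Suc (Suc (2 * m)) = 2 * Suc m" by simp
  then show ?thesis
    using fact_even_moment_Suc[of m] unfolding gaussian_mean_def poly_monom k
    by (simp only: std_normal_distribution_even_moments mult_1)
next
  case False
  then show ?thesis
    using integral_std_normal_distribution_moment_odd[of k]
      integral_std_normal_distribution_moment_odd[of "Suc (Suc k)"]
    by (simp add: gaussian_mean_def poly_monom del: power_Suc)
qed

lemma gaussian_mean_power_one: "gaussian_mean (poly (monom 1 (Suc 0))) = 0"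
  using integral_std_normal_distribution_moment_odd[of 1]
  by (simp add: gaussian_mean_def poly_monom)

text \<open>Both sides are linear in \<open>p\<close>, which leaves monomials: constants need the
  vanishing first moment, higher degrees the moment recurrence.\<close>

lemma gaussian_integration_by_parts:
  "gaussian_mean (poly ([:0, 1:] * p)) = gaussian_mean (poly (pderiv p))"
proof -
  have X: "[:0, 1:] * q = monom 1 1 * q" for q :: "real poly"
    by (simp add: monom_Suc)
  \<comment> \<open>The extra monomial factor makes the statement inductive in \<open>p\<close>.\<close>
  have "gaussian_mean (poly ([:0, 1:] * (monom 1 k * p))) = gaussian_mean (poly (pderiv (monom 1 k * p)))"
    for k
  proof (induction p arbitrary: k rule: pCons_induct)
    case 0
    show ?case by simp
  next
    case (pCons a p)
    have split: "monom 1 k * pCons a p = smult a (monom 1 k) + monom 1 (Suc k) * p"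
      by (simp add: monom_Suc smult_monom mult.commute)
    have base: "gaussian_mean (poly ([:0, 1:] * monom 1 k)) = gaussian_mean (poly (pderiv (monom 1 k)))"
    proof (cases k)
      case 0
      have "[:0, 1:] * monom (1::real) k = monom 1 (Suc 0)"
        by (simp add: 0 monom_Suc)
      then show ?thesis
        by (simp only: gaussian_mean_power_one) (simp add: 0 pderiv_1 gaussian_mean_poly_zero)
    next
      case (Suc j)
      have "pderiv (monom (1::real) k) = smult (real (Suc j)) (monom 1 j)"
        by (simp add: Suc pderiv_monom smult_monom)
      moreover have "[:0, 1:] * monom (1::real) k = monom 1 (Suc (Suc j))"
        by (simp add: Suc monom_Suc)
      ultimately show ?thesis
        by (simp only: gaussian_mean_power_Suc_Suc gaussian_mean_poly_smult)
    qed
    show ?case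
      unfolding split
      by (simp only: distrib_left pderiv_add gaussian_mean_poly_add pCons.IH mult_smult_right
          pderiv_smult gaussian_mean_poly_smult base)
  qed
  from this[of 0] show ?thesis by simp
qed

section \<open>Hermite means: orthogonality, dilation and Gaussian damping\<close>

text \<open>The raising operator of the recursion is adjoint to differentiation under the Gaussian
  mean.\<close>

lemma gaussian_mean_hermite_Suc_mult:
  "gaussian_mean (poly (hermite_poly (Suc n) * q)) = gaussian_mean (poly (hermite_poly n * pderiv q))"
proof -
  have "hermite_poly (Suc n) * q = [:0, 1:] * (hermite_poly n * q) - pderiv (hermite_poly n) * q"
    by (simp add: algebra_simps)
  then have "gaussian_mean (poly (hermite_poly (Suc n) * q)) =
      gaussian_mean (poly (pderiv (hermite_poly n * q) - pderiv (hermite_poly n) * q))"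
    by (simp only: gaussian_mean_poly_diff gaussian_integration_by_parts)
  then show ?thesis
    by (simp add: pderiv_mult mult.commute)
qed

text \<open>Each step strips one raising operator from the left factor and lowers \<open>H_m\<close>
  to \<open>m H_(m-1)\<close>; for equal indices the factors accumulate to
  \<open>n!\<close>.\<close>

lemma gaussian_mean_hermite_hermite:
  "gaussian_mean (poly (hermite_poly n * hermite_poly m)) = (if n = m then fact n else 0)"
proof (induction n arbitrary: m)
  case 0
  show ?case
  proof (cases m)
    case (Suc k)
    then show ?thesis
      \<comment> \<open>Adjointness against the constant 1, whose derivative is zero, gives
        \<open>H_(k+1)\<close> mean zero.\<close>
      using gaussian_mean_hermite_Suc_mult[of k 1]
      by (simp only: hermite_poly.simps(1) mult_1_left mult_1_right pderiv_1 mult_zero_right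
          gaussian_mean_poly_zero) simp
  qed (simp add: gaussian_mean_one)
next
  case (Suc n)
  show ?case
    by (cases m)
       (auto simp only: gaussian_mean_hermite_Suc_mult pderiv_hermite_poly mult_smult_right
          gaussian_mean_poly_smult Suc diff_Suc_1 fact_Suc of_nat_0 mult_zero_left split: if_splits)
qed

text \<open>With \<open>E_n\<close> the mean of \<open>H_n(t Z)\<close>, the recurrence is
  \<open>E_(n+2) = (n+1) (t^2 - 1) E_n\<close>; the starting values 1 and 0 separate even from odd
  indices.\<close>

lemma gaussian_mean_hermite_scaled:
  fixes t :: real
  shows "gaussian_mean (poly (hermite_poly n \<circ>\<^sub>p [:0, t:])) =
    (if even n then fact n / (2 ^ (n div 2) * fact (n div 2)) * (t\<^sup>2 - 1) ^ (n div 2) else 0)"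
proof (induction n rule: induct_nat_012)
  case 0
  show ?case by (simp add: pcompose_1 gaussian_mean_one)
next
  case 1
  have "hermite_poly (Suc 0) \<circ>\<^sub>p [:0, t:] = smult t (monom 1 (Suc 0))"
    by (simp add: monom_Suc pcompose_pCons)
  then show ?case
    by (simp only: gaussian_mean_poly_smult gaussian_mean_power_one) simp
next
  case (ge2 n)
  let ?c = "\<lambda>p. p \<circ>\<^sub>p [:0, t:]"
  have "?c (hermite_poly (Suc (Suc n))) =
      smult t ([:0, 1:] * ?c (hermite_poly (Suc n))) - smult (real (Suc n)) (?c (hermite_poly n))"
    by (simp only: hermite_poly.simps(2)[of "Suc n"] pderiv_hermite_poly pcompose_diff pcompose_mult
        pcompose_smult diff_Suc_1) (simp add: pcompose_pCons)
  moreover have "pderiv (?c (hermite_poly (Suc n))) = smult (t * real (Suc n)) (?c (hermite_poly n))"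
    by (simp add: pderiv_pcompose pderiv_hermite_poly pcompose_smult pderiv_pCons mult.commute
        del: hermite_poly.simps of_nat_Suc)
  \<comment> \<open>One \<open>t\<close> comes from the scaled variable and one from the chain rule
    after integration by parts; the lowering term contributes the \<open>-1\<close>.\<close>
  ultimately have rec: "gaussian_mean (poly (?c (hermite_poly (Suc (Suc n))))) =
      real (Suc n) * (t\<^sup>2 - 1) * gaussian_mean (poly (?c (hermite_poly n)))"
    by (simp only: gaussian_mean_poly_diff gaussian_mean_poly_smult gaussian_integration_by_parts)
       (simp add: algebra_simps power2_eq_square)
  show ?case
  proof (cases "even n")
    case True
    then obtain k where n: "n = 2 * k" by (elim evenE)
    have "gaussian_mean (poly (?c (hermite_poly (Suc (Suc n))))) =
        fact (Suc (Suc (2 * k))) / (2 ^ Suc k * fact (Suc k)) * (t\<^sup>2 - 1) ^ Suc k"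
      using ge2(1) unfolding rec fact_even_moment_Suc by (simp add: n)
    then show ?thesis
      by (simp add: n del: hermite_poly.simps fact_Suc)
  qed (use rec ge2(1) in \<open>simp del: hermite_poly.simps\<close>)
qed

text \<open>The damped Gaussian density is an unnormalised Gaussian of variance
  \<open>1 / (1 + 2 * d)\<close>; a dilation restores unit variance.\<close>

lemma gaussian_mean_exp_weight:
  assumes c: "1 + 2 * d > 0" and [measurable]: "f \<in> borel_measurable borel"
  shows "gaussian_mean (\<lambda>x. exp (- d * x\<^sup>2) * f x) =
    sqrt (1 / (1 + 2 * d)) * gaussian_mean (\<lambda>x. f (x / sqrt (1 + 2 * d)))"
proof -
  let ?r = "sqrt (1 + 2 * d)"
  have r: "?r > 0" using c by simp
  have "(LINT x|lborel. exp (- d * x\<^sup>2) * f x * exp (- (x\<^sup>2 / 2))) =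
      (1 / ?r) * (LINT x|lborel. exp (- d * (x / ?r)\<^sup>2) * f (x / ?r) * exp (- ((x / ?r)\<^sup>2 / 2)))"
    using r by (subst lborel_integral_real_affine[of "1 / ?r" _ 0]) auto
  also have "(\<lambda>x. exp (- d * (x / ?r)\<^sup>2) * f (x / ?r) * exp (- ((x / ?r)\<^sup>2 / 2))) =
      (\<lambda>x. f (x / ?r) * exp (- (x\<^sup>2 / 2)))"
  proof
    fix x
    \<comment> \<open>The exponents combine because
      \<open>(d + 1/2) / (1 + 2 * d) = 1/2\<close>.\<close>
    have "- d * (x / ?r)\<^sup>2 + - ((x / ?r)\<^sup>2 / 2) = - (x\<^sup>2 / 2)"
      using c by (simp add: power_divide divide_simps) (simp add: algebra_simps)
    then have "exp (- d * (x / ?r)\<^sup>2) * exp (- ((x / ?r)\<^sup>2 / 2)) = exp (- (x\<^sup>2 / 2))"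
      by (simp only: exp_add[symmetric])
    then show "exp (- d * (x / ?r)\<^sup>2) * f (x / ?r) * exp (- ((x / ?r)\<^sup>2 / 2)) = f (x / ?r) * exp (- (x\<^sup>2 / 2))"
      by (simp only: mult_ac)
  qed
  finally show ?thesis
    by (simp add: gaussian_mean_eq real_sqrt_divide)
qed

section \<open>The linear system at the nodes\<close>

text \<open>Monic polynomials, one in each degree, span: removing the leading term by a Hermite
  polynomial lowers the degree.\<close>

lemma sum_hermite_eq_zero_imp_sum_poly_eq_zero:
  fixes u x :: "nat \<Rightarrow> real"
  assumes "\<And>n. n < N \<Longrightarrow> (\<Sum>j\<in>A. u j * poly (hermite_poly n) (x j)) = 0" and "degree p < N"
  shows "(\<Sum>j\<in>A. u j * poly p (x j)) = 0"
  using assms(2)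
proof (induction "degree p" arbitrary: p rule: less_induct)
  case less
  define q where "q = p - smult (lead_coeff p) (hermite_poly (degree p))"
  have p: "p = q + smult (lead_coeff p) (hermite_poly (degree p))"
    by (simp add: q_def)
  have "(\<Sum>j\<in>A. u j * poly q (x j)) = 0"
  \<comment> \<open>The degree of a constant cannot drop, but then \<open>H_0 = 1\<close> makes
    \<open>q\<close> zero.\<close>
  proof (cases "degree p = 0")
    case True
    then obtain a where "p = [:a:]" by (elim degree_eq_zeroE)
    then show ?thesis by (simp add: q_def)
  next
    case False
    have "degree q \<le> degree p"
      unfolding q_def by (intro degree_diff_le) (auto intro: order_trans[OF degree_smult_le])
    moreover have "coeff q (degree p) = 0"
      by (simp add: q_def)
    ultimately have "degree q < degree p"
      using False by (metis degree_0 leading_coeff_0_iff le_neq_implies_less neq0_conv)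
    then show ?thesis
      using less by simp
  qed
  moreover have "(\<Sum>j\<in>A. u j * poly (hermite_poly (degree p)) (x j)) = 0"
    using less.prems assms(1) by simp
  ultimately show ?case
    by (subst p)
       (simp add: distrib_left sum.distrib mult.left_commute[of _ "lead_coeff p"] flip: sum_distrib_left)
qed

text \<open>Testing against the unnormalised Lagrange basis polynomial, which vanishes at every node
  except \<open>x i\<close>, isolates \<open>u i\<close>.\<close>

lemma sum_hermite_eq_zero_imp_zero:
  fixes u x :: "nat \<Rightarrow> real"
  assumes "finite A" "card A = N" "inj_on x A"
    and "\<And>n. n < N \<Longrightarrow> (\<Sum>j\<in>A. u j * poly (hermite_poly n) (x j)) = 0" and "i \<in> A"
  shows "u i = 0"
proof -
  define p where "p = (\<Prod>j\<in>A - {i}. [:- x j, 1:])"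
  have "degree p = card (A - {i})"
    unfolding p_def by (subst degree_prod_eq_sum_degree) auto
  also have "\<dots> < N"
    using assms by (metis card_Diff1_less)
  finally have "(\<Sum>j\<in>A. u j * poly p (x j)) = 0"
    using assms(4) by (rule sum_hermite_eq_zero_imp_sum_poly_eq_zero[rotated])
  also have "(\<Sum>j\<in>A. u j * poly p (x j)) = u i * poly p (x i) + (\<Sum>j\<in>A - {i}. u j * poly p (x j))"
    using assms by (intro sum.remove)
  also have "(\<Sum>j\<in>A - {i}. u j * poly p (x j)) = 0"
    using assms(1) by (intro sum.neutral) (auto simp: p_def poly_prod)
  finally have "u i * poly p (x i) = 0" by simp
  moreover have "poly p (x i) \<noteq> 0"
    using assms(1,3,5) by (auto simp: p_def poly_prod inj_on_def)
  ultimately show ?thesis by simp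
qed

text \<open>For arbitrary targets \<open>M\<close>, orthogonality verifies the explicit solution;
  any other solution differs from it by one of the homogeneous system, hence by zero at distinct
  nodes.\<close>

lemma gauss_hermite_interpolation_weights:
  assumes "gauss_hermite_rule N x w"
  shows "(\<forall>n<N. (\<Sum>j = 1..N. v j * poly (hermite_poly n) (x j)) = M n) \<longleftrightarrow>
    (\<forall>j\<in>{1..N}. v j = w j * (\<Sum>m<N. M m / fact m * poly (hermite_poly m) (x j)))"
proof -
  let ?v = "\<lambda>j. w j * (\<Sum>m<N. M m / fact m * poly (hermite_poly m) (x j))"
  have exact: "(\<Sum>j = 1..N. ?v j * poly (hermite_poly n) (x j)) = M n" if n: "n < N" for n
  proof -
    have "(\<Sum>j = 1..N. ?v j * poly (hermite_poly n) (x j)) =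
        (\<Sum>j = 1..N. \<Sum>m<N. M m / fact m * (w j * poly (hermite_poly n * hermite_poly m) (x j)))"
      by (simp add: sum_distrib_left sum_distrib_right mult_ac)
    also have "\<dots> = (\<Sum>m<N. M m / fact m * quadrature N x w (poly (hermite_poly n * hermite_poly m)))"
      by (subst sum.swap) (simp add: quadrature_def sum_distrib_left)
    also have "\<dots> = (\<Sum>m<N. M m / fact m * (if n = m then fact n else 0))"
    proof (intro sum.cong refl)
      fix m assume "m \<in> {..<N}"
      \<comment> \<open>Both factors have degree at most \<open>N - 1\<close>, so the product has
        degree at most \<open>2 * N - 2\<close>.\<close>
      then have "degree (hermite_poly n * hermite_poly m) \<le> 2 * N - 1"
        using n degree_mult_le[of "hermite_poly n" "hermite_poly m"] by simp
      then have "quadrature N x w (poly (hermite_poly n * hermite_poly m)) = (if n = m then fact n else 0)"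
        using assms by (simp only: gauss_hermite_rule_def gaussian_mean_hermite_hermite)
      then show "M m / fact m * quadrature N x w (poly (hermite_poly n * hermite_poly m)) =
          M m / fact m * (if n = m then fact n else 0)" by simp
    qed
    also have "\<dots> = (\<Sum>m<N. if n = m then M m else 0)"
      by (intro sum.cong) auto
    also have "\<dots> = M n"
      using n by simp
    finally show ?thesis .
  qed
  show ?thesis
  proof
    assume v: "\<forall>n<N. (\<Sum>j = 1..N. v j * poly (hermite_poly n) (x j)) = M n"
    have "v i - ?v i = 0" if "i \<in> {1..N}" for i
    proof (rule sum_hermite_eq_zero_imp_zero[of "{1..N}" N x "\<lambda>j. v j - ?v j"])
      show "(\<Sum>j = 1..N. (v j - ?v j) * poly (hermite_poly n) (x j)) = 0" if "n < N" for n
        using v exact that by (simp add: left_diff_distrib sum_subtractf)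
    qed (use assms that in \<open>auto simp: gauss_hermite_rule_def\<close>)
    then show "\<forall>j\<in>{1..N}. v j = ?v j" by simp
  next
    assume "\<forall>j\<in>{1..N}. v j = ?v j"
    then show "\<forall>n<N. (\<Sum>j = 1..N. v j * poly (hermite_poly n) (x j)) = M n"
      using exact by simp
  qed
qed

section \<open>Eigenfunction means and the final weights\<close>

text \<open>For \<open>N \<ge> 1\<close>, \<open>(N - 1) div 2\<close> is the largest
  \<open>m\<close> with \<open>2 * m < N\<close>.\<close>

lemma sum_lessThan_even:
  fixes f :: "nat \<Rightarrow> 'a :: comm_monoid_add"
  assumes "N \<ge> 1" and "\<And>n. odd n \<Longrightarrow> f n = 0"
  shows "(\<Sum>n<N. f n) = (\<Sum>m = 0..(N - 1) div 2. f (2 * m))"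
proof -
  have "(\<Sum>m = 0..(N - 1) div 2. f (2 * m)) = sum f ((*) 2 ` {0..(N - 1) div 2})"
    by (subst sum.reindex) (auto simp: inj_on_def)
  also have "\<dots> = (\<Sum>n<N. f n)"
  proof (rule sum.mono_neutral_left)
    show "(*) 2 ` {0..(N - 1) div 2} \<subseteq> {..<N}"
      using assms(1) by auto
    show "\<forall>n\<in>{..<N} - (*) 2 ` {0..(N - 1) div 2}. f n = 0"
    proof
      fix n assume n: "n \<in> {..<N} - (*) 2 ` {0..(N - 1) div 2}"
      have "odd n"
      proof
        assume "even n"
        then obtain m where "n = 2 * m" by (elim evenE)
        with n show False by auto
      qed
      then show "f n = 0" by (rule assms(2))
    qed
  qed simp
  finally show ?thesis ..
qed

lemma beta_ge_1: "beta ell \<alpha> \<ge> 1"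
  unfolding beta_def by (rule ge_one_powr_ge_zero) auto

text \<open>Ensures \<open>1 + 2 * delta_sq ell \<alpha> > 0\<close>, the condition for the change
  of variance.\<close>

lemma delta_sq_nonneg: "delta_sq ell \<alpha> \<ge> 0"
  using beta_ge_1[of ell \<alpha>] by (simp add: delta_sq_def)

text \<open>The change of variance leaves a scaled Hermite mean with \<open>t = sqrt 2 * \<alpha> *
  beta ell \<alpha> / sqrt (1 + 2 * delta_sq ell \<alpha>)\<close>; its \<open>t^2 - 1\<close> is
  the base of the powers.\<close>

lemma gaussian_mean_mercer_eigenfun:
  "gaussian_mean (mercer_eigenfun ell \<alpha> n) = sqrt (beta ell \<alpha> / fact n) *
    (sqrt (1 / (1 + 2 * delta_sq ell \<alpha>)) *
      (if even n then fact n / (2 ^ (n div 2) * fact (n div 2)) *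
        (2 * \<alpha>\<^sup>2 * (beta ell \<alpha>)\<^sup>2 / (1 + 2 * delta_sq ell \<alpha>) - 1) ^ (n div 2) else 0))"
proof -
  let ?d = "delta_sq ell \<alpha>" and ?s = "sqrt 2 * \<alpha> * beta ell \<alpha>"
  let ?c = "1 + 2 * ?d" and ?f = "\<lambda>x. poly (hermite_poly n) (sqrt 2 * \<alpha> * beta ell \<alpha> * x)"
  have c: "?c > 0" using delta_sq_nonneg[of ell \<alpha>] by simp
  have f: "?f \<in> borel_measurable borel" by measurable
  have "gaussian_mean (mercer_eigenfun ell \<alpha> n) =
      sqrt (beta ell \<alpha> / fact n) * gaussian_mean (\<lambda>x. exp (- ?d * x\<^sup>2) * ?f x)"
    by (simp add: gaussian_mean_def mercer_eigenfun_def[abs_def] hermite_eq_poly mult.assoc)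
  also have "gaussian_mean (\<lambda>x. exp (- ?d * x\<^sup>2) * ?f x) =
      sqrt (1 / ?c) * gaussian_mean (poly (hermite_poly n \<circ>\<^sub>p [:0, ?s / sqrt ?c:]))"
    by (simp only: gaussian_mean_exp_weight[OF c f])
       (simp add: poly_pcompose[abs_def] o_def mult_ac)
  also have "(?s / sqrt ?c)\<^sup>2 = 2 * \<alpha>\<^sup>2 * (beta ell \<alpha>)\<^sup>2 / ?c"
    using c by (simp add: power_divide power_mult_distrib)
  then have "gaussian_mean (poly (hermite_poly n \<circ>\<^sub>p [:0, ?s / sqrt ?c:])) =
      (if even n then fact n / (2 ^ (n div 2) * fact (n div 2)) *
        (2 * \<alpha>\<^sup>2 * (beta ell \<alpha>)\<^sup>2 / ?c - 1) ^ (n div 2) else 0)"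
    by (simp only: gaussian_mean_hermite_scaled)
  finally show ?thesis .
qed

theorem theorem2p2:
  fixes ell \<alpha> :: real and N :: nat and x w xt wt :: "nat \<Rightarrow> real"
  assumes "ell > 0" and "\<alpha> > 0" and "N \<ge> 1"
    and "gauss_hermite_rule N x w"
    and "\<And>n. n \<in> {1..N} \<Longrightarrow> xt n = 1 / (sqrt 2 * \<alpha> * beta ell \<alpha>) * x n"
  shows "(\<forall>n \<in> {0..N - 1}. quadrature N xt wt (mercer_eigenfun ell \<alpha> n)
                              = gaussian_mean (mercer_eigenfun ell \<alpha> n))
     \<longleftrightarrow> (\<forall>n \<in> {1..N}. wt n =
            sqrt (1 / (1 + 2 * delta_sq ell \<alpha>)) * w n * exp (delta_sq ell \<alpha> * (xt n)\<^sup>2) *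
            (\<Sum>m = 0..(N - 1) div 2. 1 / (2 ^ m * fact m) *
               (2 * \<alpha>\<^sup>2 * (beta ell \<alpha>)\<^sup>2 / (1 + 2 * delta_sq ell \<alpha>) - 1) ^ m * hermite (2 * m) (x n)))"
proof -
  define b d q where "b = beta ell \<alpha>" and "d = delta_sq ell \<alpha>"
    and "q = 2 * \<alpha>\<^sup>2 * b\<^sup>2 / (1 + 2 * d) - 1"
  \<comment> \<open>\<open>M n\<close> is the eigenfunction mean without its normalising factor
    \<open>sqrt (b / fact n)\<close>.\<close>
  define M :: "nat \<Rightarrow> real" where "M n = sqrt (1 / (1 + 2 * d)) *
    (if even n then fact n / (2 ^ (n div 2) * fact (n div 2)) * q ^ (n div 2) else 0)" for n
  define v where "v j = wt j * exp (- d * (xt j)\<^sup>2)" for j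
  have b: "b > 0" using beta_ge_1[of ell \<alpha>] by (simp add: b_def)
  \<comment> \<open>The node scaling puts the Hermite argument of the eigenfunctions exactly at the
    Gauss-Hermite nodes.\<close>
  have "sqrt 2 * \<alpha> * b * xt j = x j" if "j \<in> {1..N}" for j
    using assms(5)[OF that] b assms(2) by (simp add: b_def)
  then have "quadrature N xt wt (mercer_eigenfun ell \<alpha> n) =
      sqrt (b / fact n) * (\<Sum>j = 1..N. v j * poly (hermite_poly n) (x j))" for n
    unfolding quadrature_def mercer_eigenfun_def hermite_eq_poly b_def[symmetric] d_def[symmetric]
    by (simp add: v_def sum_distrib_left mult_ac)
  moreover have "gaussian_mean (mercer_eigenfun ell \<alpha> n) = sqrt (b / fact n) * M n" for n
    unfolding gaussian_mean_mercer_eigenfun M_def q_def b_def d_def ..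
  ultimately have "(\<forall>n\<in>{0..N - 1}. quadrature N xt wt (mercer_eigenfun ell \<alpha> n) =
        gaussian_mean (mercer_eigenfun ell \<alpha> n)) \<longleftrightarrow>
      (\<forall>n<N. (\<Sum>j = 1..N. v j * poly (hermite_poly n) (x j)) = M n)"
    \<comment> \<open>The common factor \<open>sqrt (b / fact n)\<close> is nonzero and cancels;
      \<open>N \<ge> 1\<close> matches the index ranges.\<close>
    using b assms(3) by (auto simp: Ball_def)
  also have "\<dots> \<longleftrightarrow> (\<forall>j\<in>{1..N}. v j = w j * (\<Sum>m<N. M m / fact m * poly (hermite_poly m) (x j)))"
    using assms(4) by (rule gauss_hermite_interpolation_weights)
  also have "\<dots> \<longleftrightarrow> (\<forall>j\<in>{1..N}. wt j = sqrt (1 / (1 + 2 * d)) * w j * exp (d * (xt j)\<^sup>2) *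
      (\<Sum>m = 0..(N - 1) div 2. 1 / (2 ^ m * fact m) * q ^ m * hermite (2 * m) (x j)))"
  proof (intro ball_cong refl)
    fix j
    let ?S = "\<Sum>m = 0..(N - 1) div 2. 1 / (2 ^ m * fact m) * q ^ m * hermite (2 * m) (x j)"
    have "(\<Sum>m<N. M m / fact m * poly (hermite_poly m) (x j)) =
        (\<Sum>m = 0..(N - 1) div 2. M (2 * m) / fact (2 * m) * poly (hermite_poly (2 * m)) (x j))"
      using assms(3) by (rule sum_lessThan_even) (simp add: M_def)
    \<comment> \<open>The \<open>fact (2 * m)\<close> inside \<open>M (2 * m)\<close> cancels the
      denominator, leaving \<open>1 / (2 ^ m * fact m)\<close>.\<close>
    also have "\<dots> = sqrt (1 / (1 + 2 * d)) * ?S"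
      by (simp add: M_def hermite_eq_poly sum_distrib_left mult_ac)
    finally have S: "(\<Sum>m<N. M m / fact m * poly (hermite_poly m) (x j)) = sqrt (1 / (1 + 2 * d)) * ?S" .
    have "v j = a \<longleftrightarrow> wt j = a * exp (d * (xt j)\<^sup>2)" for a
      by (simp add: v_def exp_minus field_simps)
    then show "v j = w j * (\<Sum>m<N. M m / fact m * poly (hermite_poly m) (x j)) \<longleftrightarrow>
        wt j = sqrt (1 / (1 + 2 * d)) * w j * exp (d * (xt j)\<^sup>2) * ?S"
      unfolding S by (simp only: mult_ac)
  qed
  finally show ?thesis
    unfolding b_def d_def q_def .
qed

end
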